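(* Let $r\ge1$ and $n>r$ be integers, let $E_j=[\alpha_j,\beta_j]\subseteq[0,2\pi)$, $j=1,\dots,r$, be pairwise disjoint intervals of equal length $\Delta=\beta_j-\alpha_j>0$, with centers $\theta_j=\frac{\alpha_j+\beta_j}2$, and suppose that the points $x_j=e^{i\theta_j}$ satisfy $x_j=x_1\rho^{j-1}$, $\rho=e^{2\pi i/r}$, $j=1,\dots,r$. Consider the multi-index $\vec n=(n-r,1,\dots,1)\in\mathbb N^{r+1}$ and the weights on the unit circle $\omega^{(1)}(e^{i\theta})=1$, $\omega^{(j+1)}(e^{i\theta})=\mathbf 1_{E_j}(\theta)$, $j=1,\dots,r$; assume that the type II polynomial $\Phi_{\vec n}$ exists and is unique, and that $a_na_{n-r}\ne0$. Then $$\Phi_{\vec n}(z)=z^n-\left(\frac{a_n}{a_{n-r}}x_1^r\right)z^{n-r}=z^{n-r}\left(z^r-\frac{a_n}{a_{n-r}}x_1^r\right).$$ Hence $\Phi_{\vec n}$ has a zero of multiplicity $n-r$ at the origin and $r$ simple nonzero zeros $$\zeta_k=\left|\frac{n-r}n\,\frac{\sin\left(\frac{n\Delta}2\right)}{\sin\left(\frac{(n-r)\Delta}2\right)}\right|^{1/r}e^{i\vartheta_k},\qquad\vartheta_k=\theta_1+\frac{\arg(a_n/a_{n-r})+2\pi k}r,\quad k=0,\dots,r-1,$$ where $\arg(a_n/a_{n-r})\in\{0,\pi\}$ since $a_n/a_{n-r}$ is real.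
   Context: Type II polynomial: for weights $\omega^{(1)},\dots,\omega^{(r+1)}$ on $\mathbb T=\{|z|=1\}$ and multi-index $\vec n=(n_1,\dots,n_{r+1})$ with $n=\sum_jn_j$, $\Phi_{\vec n}$ is a monic polynomial of degree $n$ with $\int_{\mathbb T}\Phi_{\vec n}(z)\overline{z^k}\omega^{(j)}(z)\frac{|dz|}{2\pi}=0$ for $k=0,\dots,n_j-1$, $j=1,\dots,r+1$. Notation: $a_\ell=\frac1{\ell\pi}\sin\left(\frac{\ell\Delta}2\right)$ for $\ell\ne0$ and $a_0=\frac{\Delta}{2\pi}$. *)

theory Defs
  imports "HOL-Analysis.Analysis" "HOL-Computational_Algebra.Polynomial"
begin

text \<open>Integral over the unit circle against the normalised arc length measure \<open>|dz| / (2\<pi>)\<close>.\<close>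

definition circle_integral :: "(complex \<Rightarrow> complex) \<Rightarrow> complex" where
  "circle_integral f = (LINT \<theta>:{0..<2 * pi}|lborel. f (cis \<theta>)) / complex_of_real (2 * pi)"

text \<open>The \<open>s\<close> weights \<open>w 1, \<dots>, w s\<close> and the components \<open>N 1, \<dots>, N s\<close> of the multi-index
  are indexed from 1; values at other indices are irrelevant.\<close>

definition is_type_II :: "nat \<Rightarrow> (nat \<Rightarrow> complex \<Rightarrow> real) \<Rightarrow> (nat \<Rightarrow> nat) \<Rightarrow> complex poly \<Rightarrow> bool" where
  "is_type_II s w N P \<longleftrightarrow>
     lead_coeff P = 1 \<and> degree P = (\<Sum>j=1..s. N j) \<and>
     (\<forall>j\<in>{1..s}. \<forall>k<N j.
        circle_integral (\<lambda>z. poly P z * cnj (z ^ k) * complex_of_real (w j z)) = 0)"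

text \<open>The \<open>l\<close>-th Fourier coefficient (for \<open>d\<theta> / (2\<pi>)\<close>) of the indicator of an arc of length \<open>\<Delta>\<close>
  centred at 1; hence the separate value at \<open>l = 0\<close>.\<close>

definition a_coeff :: "real \<Rightarrow> int \<Rightarrow> real" where
  "a_coeff \<Delta> l =
     (if l = 0 then \<Delta> / (2 * pi)
      else 1 / (real_of_int l * pi) * sin (real_of_int l * \<Delta> / 2))"

end

theory Submission
  imports Defs
begin

text \<open>Since \<open>x\<^sub>j ^ r = x\<^sub>1 ^ r\<close> for all \<open>j\<close>, the binomial \<open>z ^ n - q x\<^sub>1 ^ r z ^ (n - r)\<close> satisfies every
  orthogonality relation: its exponents are at least \<open>n - r\<close>, and its integral over the \<open>j\<close>-th arc
  is \<open>a\<^sub>n x\<^sub>j ^ n - q x\<^sub>1 ^ r a\<^bsub>n-r\<^esub> x\<^sub>j ^ (n - r) = a\<^sub>n x\<^sub>j ^ (n - r) (x\<^sub>j ^ r - x\<^sub>1 ^ r) = 0\<close>. Uniqueness identifies it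
  with \<open>\<Phi>\<close>, and its zeros can be read off.\<close>

section \<open>Integrals of \<open>cis (m * t)\<close> over intervals and arcs\<close>

lemma interval_integrable_cis:
  "interval_lebesgue_integrable lborel (ereal a) (ereal b) (\<lambda>t. cis (m * t))"
  unfolding cis_conv_exp by (rule interval_integrable_isCont) (intro continuous_intros)

lemma interval_integral_cis:
  fixes m :: real
  assumes "m \<noteq> 0"
  shows "(LBINT t=ereal a..ereal b. cis (m * t)) = (cis (m * b) - cis (m * a)) / (\<i> * m)"
proof -
  have "(LBINT t=ereal a..ereal b. cis (m * t)) = cis (m * b) / (\<i> * m) - cis (m * a) / (\<i> * m)"
  proof (rule interval_integral_FTC_finite)
    show "continuous_on {min a b..max a b} (\<lambda>t. cis (m * t))"
      unfolding cis_conv_exp by (intro continuous_intros)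
    show "((\<lambda>t. cis (m * t) / (\<i> * m)) has_vector_derivative cis (m * t))
            (at t within {min a b..max a b})" for t
      unfolding cis_conv_exp using assms
      by (auto intro!: derivative_eq_intros has_vector_derivative_real_field simp: field_simps)
  qed
  then show ?thesis by (simp add: diff_divide_distrib)
qed

lemma interval_integral_cis_binomial:
  fixes l m :: real
  assumes "l \<noteq> 0" "m \<noteq> 0"
  shows "(LBINT t=ereal a..ereal b. cis (l * t) - c * cis (m * t))
    = (cis (l * b) - cis (l * a)) / (\<i> * l) - c * ((cis (m * b) - cis (m * a)) / (\<i> * m))"
  using assms
  by (simp add: interval_lebesgue_integral_diff interval_integrable_cis interval_integral_cis
      interval_lebesgue_integrable_mult_right)

lemma circle_integral_interval:
  "circle_integral f = (LBINT t=ereal 0..ereal (2 * pi). f (cis t)) / complex_of_real (2 * pi)"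
  unfolding circle_integral_def using interval_integral_Ico[of 0 "2 * pi" "\<lambda>t. f (cis t)"] by simp

text \<open>The weight cuts the integrand down to the arc, and nothing of the arc is lost because it
  lies inside the period \<open>{0..<2 * pi}\<close> of the parametrisation. Passing to an interval
  integral makes the antiderivative formulas above applicable.\<close>

lemma circle_integral_arc:
  assumes "\<alpha> \<le> \<beta>" "{\<alpha>..\<beta>} \<subseteq> {0..<2 * pi}"
    and w: "\<And>t. t \<in> {0..<2 * pi} \<Longrightarrow> w (cis t) = indicator {\<alpha>..\<beta>} t"
  shows "circle_integral (\<lambda>z. f z * complex_of_real (w z))
    = (LBINT t=ereal \<alpha>..ereal \<beta>. f (cis t)) / complex_of_real (2 * pi)"
proof -
  have "(LINT t:{0..<2 * pi}|lborel. f (cis t) * complex_of_real (w (cis t)))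
      = (LINT t:{\<alpha>..\<beta>}|lborel. f (cis t))"
    unfolding set_lebesgue_integral_def
    by (rule Bochner_Integration.integral_cong) (use assms in \<open>auto simp: indicator_def\<close>)
  also have "\<dots> = (LBINT t=ereal \<alpha>..ereal \<beta>. f (cis t))"
    using assms(1) by (simp add: interval_integral_Icc)
  finally show ?thesis unfolding circle_integral_def by simp
qed

text \<open>The left side is the integral of \<open>cis (l * t)\<close> over \<open>[a, b]\<close>.
  Pulling out the phase of the midpoint leaves the endpoints symmetric, and
  \<open>cis \<delta> - cis (- \<delta>) = 2 * \<i> * sin \<delta>\<close> produces the sine in
  \<open>a_coeff\<close>.\<close>

lemma a_coeff_arc:
  assumes "l \<noteq> 0"
  shows "(cis (real l * b) - cis (real l * a)) / (\<i> * real l)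
    = complex_of_real (2 * pi * a_coeff (b - a) (int l)) * cis ((a + b) / 2) ^ l"
proof -
  define \<mu> \<delta> where "\<mu> = real l * ((a + b) / 2)" and "\<delta> = real l * (b - a) / 2"
  have "real l * b = \<mu> + \<delta>" "real l * a = \<mu> - \<delta>"
    by (simp_all add: \<mu>_def \<delta>_def field_simps)
  then have "cis (real l * b) - cis (real l * a) = 2 * \<i> * sin \<delta> * cis \<mu>"
    by (simp add: complex_eq_iff cos_add cos_diff sin_add sin_diff)
  moreover have "cis ((a + b) / 2) ^ l = cis \<mu>"
    by (simp add: Complex.DeMoivre \<mu>_def)
  moreover have "2 * pi * a_coeff (b - a) (int l) = 2 * sin \<delta> / real l"
    using assms by (simp add: a_coeff_def \<delta>_def)
  ultimately show ?thesis using assms by simp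
qed

section \<open>The candidate binomial with a free coefficient \<open>c\<close>: degree and
  multiplicities of its zeros\<close>

definition binom_poly :: "nat \<Rightarrow> nat \<Rightarrow> complex \<Rightarrow> complex poly" where
  "binom_poly n r c = monom 1 n - monom c (n - r)"

lemma poly_binom_poly: "poly (binom_poly n r c) z = z ^ n - c * z ^ (n - r)"
  by (simp add: binom_poly_def poly_monom)

lemma binom_poly_factor:
  assumes "r \<le> n"
  shows "binom_poly n r c = monom 1 (n - r) * (monom 1 r - [:c:])"
  using assms by (simp add: binom_poly_def algebra_simps mult_monom smult_monom)

lemma degree_binom_poly:
  assumes "1 \<le> r" "r \<le> n"
  shows "degree (binom_poly n r c) = n"
proof (rule antisym)
  show "degree (binom_poly n r c) \<le> n"
    unfolding binom_poly_def
    by (rule degree_diff_le) (auto intro: order_trans[OF degree_monom_le])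
  show "n \<le> degree (binom_poly n r c)"
    by (rule le_degree) (use assms in \<open>simp add: binom_poly_def\<close>)
qed

lemma lead_coeff_binom_poly:
  assumes "1 \<le> r" "r \<le> n"
  shows "lead_coeff (binom_poly n r c) = 1"
  unfolding degree_binom_poly[OF assms] using assms by (simp add: binom_poly_def)

text \<open>The factor \<open>z ^ r - c\<close> takes the value \<open>- c\<close> at the origin, so
  the whole multiplicity comes from the monomial factor.\<close>

lemma order_0_binom_poly:
  assumes "1 \<le> r" "r \<le> n" "c \<noteq> 0"
  shows "order 0 (binom_poly n r c) = n - r"
proof -
  have 1: "poly (monom 1 r - [:c:]) 0 \<noteq> 0"
    using assms by (auto simp: poly_monom power_0_left)
  then have "order 0 (monom 1 r - [:c:]) = 0"
    by (rule order_0I)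
  moreover have "monom 1 (n - r) * (monom 1 r - [:c:]) \<noteq> 0"
    using 1 by auto
  moreover have "order 0 (monom (1::complex) (n - r)) = n - r"
    using order_power_n_n[of "0::complex" "n - r"] by (simp add: monom_altdef)
  ultimately show ?thesis
    by (simp add: binom_poly_factor[OF assms(2)] order_mult)
qed

text \<open>The derivative \<open>r * z ^ (r - 1)\<close> of \<open>z ^ r - c\<close> is nonzero
  away from the origin, so its roots there are simple, and the monomial factor contributes
  nothing.\<close>

lemma order_root_binom_poly:
  assumes "1 \<le> r" "r \<le> n" "z \<noteq> 0" "z ^ r = c"
  shows "order z (binom_poly n r c) = 1"
proof -
  let ?p = "monom 1 r - [:c:]"
  have d: "poly (pderiv ?p) z \<noteq> 0"
    using assms by (simp add: pderiv_diff pderiv_monom poly_monom pderiv_pCons)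
  then have p: "?p \<noteq> 0" by auto
  have "poly ?p z = 0"
    using assms by (simp add: poly_monom)
  with p have "order z ?p = Suc (order z (pderiv ?p))" by (rule order_pderiv)
  then have "order z ?p = 1" using order_0I[OF d] by simp
  moreover have "order z (monom 1 (n - r)) = 0"
    by (rule order_0I) (use assms in \<open>simp add: poly_monom\<close>)
  moreover have "monom 1 (n - r) * ?p \<noteq> 0"
    using p by simp
  ultimately show ?thesis
    by (simp add: binom_poly_factor[OF assms(2)] order_mult)
qed

section \<open>The solutions of \<open>z ^ r = c\<close> in polar form\<close>

text \<open>The listed numbers are distinct solutions, and a nonzero number has exactly
  \<open>r\<close> roots of order \<open>r\<close>, so counting shows that none is missing. The
  angle \<open>\<phi>\<close> need not be the principal argument of \<open>c\<close>, which leaves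
  the numbering of the roots free to choose.\<close>

lemma nth_roots_polar:
  fixes c :: complex and R \<phi> :: real
  assumes "r \<ge> 1" "R > 0" "c = of_real R * cis \<phi>"
  defines "\<zeta> \<equiv> \<lambda>k. complex_of_real (R powr (1 / real r)) * cis ((\<phi> + 2 * pi * real k) / real r)"
  shows "inj_on \<zeta> {..<r}" "{z. z ^ r = c} = \<zeta> ` {..<r}"
proof -
  have pw: "(R powr (1 / real r)) ^ r = R"
    using assms by (simp add: powr_realpow[symmetric] powr_powr)
  have root: "\<zeta> k ^ r = c" for k
  proof -
    have "cis ((\<phi> + 2 * pi * real k) / real r) ^ r = cis \<phi> * cis (2 * pi * real k)"
      using assms(1) by (simp add: Complex.DeMoivre cis_mult del: cis_multiple_2pi)
    also have "cis (2 * pi * real k) = 1"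
      by (rule cis_multiple_2pi) simp
    finally show ?thesis
      using pw by (simp add: \<zeta>_def power_mult_distrib assms(3) cis_multiple_2pi flip: of_real_power)
  qed
  show inj: "inj_on \<zeta> {..<r}"
  proof (rule inj_onI)
    fix k l assume kl: "k \<in> {..<r}" "l \<in> {..<r}" and "\<zeta> k = \<zeta> l"
    \<comment> \<open>Splitting off the nonzero factor independent of \<open>j\<close> reduces
      injectivity to that of the listing of the roots of unity.\<close>
    have split: "\<zeta> j = complex_of_real (R powr (1 / real r)) * cis (\<phi> / real r) * cis (2 * pi * real j / real r)" for j
      by (simp add: \<zeta>_def cis_mult add_divide_distrib mult.assoc)
    from \<open>\<zeta> k = \<zeta> l\<close> assms(2) have "cis (2 * pi * real k / real r) = cis (2 * pi * real l / real r)"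
      by (simp add: split)
    moreover have "inj_on (\<lambda>j. cis (2 * pi * real j / real r)) {..<r}"
      using bij_betw_imp_inj_on[OF Complex.bij_betw_roots_unity[of r]] assms(1) by linarith
    ultimately show "k = l" using kl by (auto dest: inj_onD)
  qed
  have "c \<noteq> 0" using assms by auto
  then have "card {z. z ^ r = c} = r" "finite {z. z ^ r = c}"
    using assms(1) card_nth_roots finite_nth_roots by auto
  moreover have "\<zeta> ` {..<r} \<subseteq> {z. z ^ r = c}" using root by auto
  ultimately show "{z. z ^ r = c} = \<zeta> ` {..<r}"
    using card_image[OF inj] by (metis card_lessThan card_subset_eq)
qed

section \<open>Orthogonality relations for the binomial\<close>

text \<open>For \<open>k < n - r\<close> both exponents \<open>n - k\<close> and
  \<open>n - r - k\<close> are positive, so each term integrates to zero over a full period,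
  whatever \<open>c\<close> is.\<close>

lemma circle_integral_binom_poly:
  assumes "r < n" "k < n - r" and w: "\<And>t. t \<in> {0..<2 * pi} \<Longrightarrow> w (cis t) = 1"
  shows "circle_integral (\<lambda>z. poly (binom_poly n r c) z * cnj (z ^ k) * complex_of_real (w z)) = 0"
proof -
  define l m where "l = real (n - k)" and "m = real (n - r - k)"
  have nz: "l \<noteq> 0" "m \<noteq> 0" using assms by (auto simp: l_def m_def)
  have "l \<in> \<int>" "m \<in> \<int>" by (auto simp: l_def m_def)
  then have per: "cis (l * (2 * pi)) = 1" "cis (m * (2 * pi)) = 1"
    using cis_multiple_2pi[of l] cis_multiple_2pi[of m] by (metis mult.commute)+
  \<comment> \<open>On the unit circle conjugation is inversion, so multiplying by
    \<open>cnj (z ^ k)\<close> lowers both exponents by \<open>k\<close>.\<close>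
  have eq: "poly (binom_poly n r c) (cis t) * cnj (cis t ^ k) = cis (l * t) - c * cis (m * t)" for t
  proof -
    have "cis (real n * t) * cis (- (real k * t)) = cis (l * t)"
      "cis (real (n - r) * t) * cis (- (real k * t)) = cis (m * t)"
      using assms by (simp_all add: cis_mult l_def m_def of_nat_diff algebra_simps)
    then show ?thesis
      by (simp add: poly_binom_poly Complex.DeMoivre cis_cnj left_diff_distrib mult.assoc)
  qed
  have "circle_integral (\<lambda>z. poly (binom_poly n r c) z * cnj (z ^ k) * complex_of_real (w z))
      = circle_integral (\<lambda>z. poly (binom_poly n r c) z * cnj (z ^ k))"
    unfolding circle_integral_def
    by (intro arg_cong2[where f = "(/)"] set_lebesgue_integral_cong) (auto simp: w)
  also have "\<dots> = (LBINT t=ereal 0..ereal (2 * pi). cis (l * t) - c * cis (m * t)) / complex_of_real (2 * pi)"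
    by (simp only: circle_integral_interval eq)
  also have "\<dots> = 0"
    by (simp only: interval_integral_cis_binomial[OF nz] per) simp
  finally show ?thesis .
qed

text \<open>Taking out the power \<open>n - r\<close> of the arc's centre isolates a bracket in
  which the centre enters only through its \<open>r\<close>-th power. Its vanishing is the condition
  on \<open>c\<close> for this arc.\<close>

lemma circle_integral_arc_binom_poly:
  assumes "r < n" "\<alpha> \<le> \<beta>" "{\<alpha>..\<beta>} \<subseteq> {0..<2 * pi}"
    and "\<And>t. t \<in> {0..<2 * pi} \<Longrightarrow> w (cis t) = indicator {\<alpha>..\<beta>} t"
  shows "circle_integral (\<lambda>z. poly (binom_poly n r c) z * complex_of_real (w z))
    = cis ((\<alpha> + \<beta>) / 2) ^ (n - r) *
      (of_real (a_coeff (\<beta> - \<alpha>) (int n)) * cis ((\<alpha> + \<beta>) / 2) ^ r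
        - c * of_real (a_coeff (\<beta> - \<alpha>) (int (n - r))))"
proof -
  define X where "X = cis ((\<alpha> + \<beta>) / 2)"
  have "circle_integral (\<lambda>z. poly (binom_poly n r c) z * complex_of_real (w z))
      = (LBINT t=ereal \<alpha>..ereal \<beta>. poly (binom_poly n r c) (cis t)) / complex_of_real (2 * pi)"
    by (rule circle_integral_arc) (use assms in auto)
  also have "\<dots> = (LBINT t=ereal \<alpha>..ereal \<beta>. cis (real n * t) - c * cis (real (n - r) * t))
      / complex_of_real (2 * pi)"
    by (simp add: poly_binom_poly Complex.DeMoivre)
  also have "\<dots> = (complex_of_real (2 * pi * a_coeff (\<beta> - \<alpha>) (int n)) * X ^ n
      - c * (complex_of_real (2 * pi * a_coeff (\<beta> - \<alpha>) (int (n - r))) * X ^ (n - r)))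
      / complex_of_real (2 * pi)"
    using assms(1) a_coeff_arc[of n \<beta> \<alpha>] a_coeff_arc[of "n - r" \<beta> \<alpha>]
    by (subst interval_integral_cis_binomial) (simp_all add: X_def)
  also have "\<dots> = of_real (a_coeff (\<beta> - \<alpha>) (int n)) * X ^ n
      - c * (of_real (a_coeff (\<beta> - \<alpha>) (int (n - r))) * X ^ (n - r))"
    by (simp add: diff_divide_distrib)
  also have "X ^ n = X ^ (n - r) * X ^ r"
    using assms(1) by (simp flip: power_add)
  finally show ?thesis unfolding X_def by (simp add: algebra_simps)
qed

lemma is_type_II_binom_poly:
  assumes r: "1 \<le> r" "r < n" and N: "N 1 = n - r" "\<And>j. j \<in> {1..r} \<Longrightarrow> N (j + 1) = 1"
    and w1: "\<And>t. t \<in> {0..<2 * pi} \<Longrightarrow> w 1 (cis t) = 1"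
    and arc: "\<And>j. j \<in> {1..r} \<Longrightarrow> \<alpha> j \<le> \<beta> j \<and> {\<alpha> j..\<beta> j} \<subseteq> {0..<2 * pi}"
    and w: "\<And>j t. j \<in> {1..r} \<Longrightarrow> t \<in> {0..<2 * pi} \<Longrightarrow> w (j + 1) (cis t) = indicator {\<alpha> j..\<beta> j} t"
    and c: "\<And>j. j \<in> {1..r} \<Longrightarrow> of_real (a_coeff (\<beta> j - \<alpha> j) (int n)) * cis ((\<alpha> j + \<beta> j) / 2) ^ r
        = c * of_real (a_coeff (\<beta> j - \<alpha> j) (int (n - r)))"
  shows "is_type_II (r + 1) w N (binom_poly n r c)"
  unfolding is_type_II_def
proof (intro conjI ballI allI impI)
  show "lead_coeff (binom_poly n r c) = 1"
    using r by (simp add: lead_coeff_binom_poly)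
  \<comment> \<open>The first weight contributes \<open>n - r\<close> conditions and each of the
    \<open>r\<close> arcs contributes one, giving degree \<open>n\<close>.\<close>
  have "(\<Sum>j=1..r + 1. N j) = N 1 + (\<Sum>j=1..r. N (j + 1))"
    using sum.atLeast_Suc_atMost[of 1 "r + 1" N] sum.shift_bounds_cl_nat_ivl[of N 1 1 r]
    by (simp add: numeral_2_eq_2)
  also have "\<dots> = n" using r N by simp
  finally show "degree (binom_poly n r c) = (\<Sum>j=1..r + 1. N j)"
    using r by (simp add: degree_binom_poly)
next
  fix j k assume j: "j \<in> {1..r + 1}" and k: "k < N j"
  show "circle_integral (\<lambda>z. poly (binom_poly n r c) z * cnj (z ^ k) * complex_of_real (w j z)) = 0"
  proof (cases "j = 1")
    case True
    with k N w1 r show ?thesis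
      by (intro circle_integral_binom_poly) auto
  next
    case False
    then obtain i where i: "j = i + 1" "i \<in> {1..r}"
      using j by (intro that[of "j - 1"]) auto
    \<comment> \<open>Each arc carries a single condition, so the conjugated power is 1 and the arc
      formula applies directly.\<close>
    with k N have "k = 0" by simp
    with circle_integral_arc_binom_poly[of r n "\<alpha> i" "\<beta> i" "w j" c] arc[OF i(2)] w[OF i(2)] c[OF i(2)] i r
    show ?thesis by simp
  qed
qed

section \<open>Identification of \<open>\<Phi>\<close> and of its zeros\<close>

theorem corollary3p11:
  fixes r n :: nat
    and \<alpha> \<beta> \<theta> :: "nat \<Rightarrow> real" and \<Delta> :: real
    and x :: "nat \<Rightarrow> complex" and \<rho> :: complex
    and N :: "nat \<Rightarrow> nat" and w :: "nat \<Rightarrow> complex \<Rightarrow> real"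
    and \<Phi> :: "complex poly"
    and q :: real and \<psi> :: "nat \<Rightarrow> real" and \<zeta> :: "nat \<Rightarrow> complex"
  defines "\<theta> \<equiv> \<lambda>j. (\<alpha> j + \<beta> j) / 2"
    and "x \<equiv> \<lambda>j. cis (\<theta> j)"
    and "\<rho> \<equiv> exp (2 * complex_of_real pi * \<i> / of_nat r)"
    and "q \<equiv> a_coeff \<Delta> (int n) / a_coeff \<Delta> (int (n - r))"
    and "\<psi> \<equiv> \<lambda>k. \<theta> 1 + (Arg (complex_of_real q) + 2 * pi * real k) / real r"
    and "\<zeta> \<equiv> \<lambda>k. complex_of_real
           (\<bar>real (n - r) / real n * (sin (real n * \<Delta> / 2) / sin (real (n - r) * \<Delta> / 2))\<bar>
              powr (1 / real r)) * cis (\<psi> k)"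
  assumes "r \<ge> 1" and "n > r"
    and "\<Delta> > 0"
    and "\<forall>j\<in>{1..r}. \<beta> j - \<alpha> j = \<Delta>"
    and "\<forall>j\<in>{1..r}. {\<alpha> j..\<beta> j} \<subseteq> {0..<2 * pi}"
    and "disjoint_family_on (\<lambda>j. {\<alpha> j..\<beta> j}) {1..r}"
    and "\<forall>j\<in>{1..r}. x j = x 1 * \<rho> ^ (j - 1)"
    and "N 1 = n - r" and "\<forall>j\<in>{1..r}. N (j + 1) = 1"
    and "\<forall>t\<in>{0..<2 * pi}. w 1 (cis t) = 1"
    and "\<forall>j\<in>{1..r}. \<forall>t\<in>{0..<2 * pi}. w (j + 1) (cis t) = indicator {\<alpha> j..\<beta> j} t"
    and "\<exists>!P. is_type_II (r + 1) w N P" and "is_type_II (r + 1) w N \<Phi>"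
    and "a_coeff \<Delta> (int n) * a_coeff \<Delta> (int (n - r)) \<noteq> 0"
  shows "(\<forall>z. poly \<Phi> z = z ^ n - (complex_of_real q * x 1 ^ r) * z ^ (n - r))
    \<and> (\<forall>z. poly \<Phi> z = z ^ (n - r) * (z ^ r - complex_of_real q * x 1 ^ r))
    \<and> order 0 \<Phi> = n - r
    \<and> inj_on \<zeta> {..<r}
    \<and> {z. z \<noteq> 0 \<and> poly \<Phi> z = 0} = \<zeta> ` {..<r}
    \<and> (\<forall>k<r. order (\<zeta> k) \<Phi> = 1)
    \<and> Arg (complex_of_real q) \<in> {0, pi}"
proof -
  define c where "c = complex_of_real q * x 1 ^ r"
  define R where "R = \<bar>real (n - r) / real n * (sin (real n * \<Delta> / 2) / sin (real (n - r) * \<Delta> / 2))\<bar>"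
  have a: "a_coeff \<Delta> (int n) \<noteq> 0" "a_coeff \<Delta> (int (n - r)) \<noteq> 0"
    using assms(20) by auto
  have q: "q \<noteq> 0" using a by (simp add: q_def)
  \<comment> \<open>Since \<open>0 < n - r < n\<close>, both coefficients are given by the sine
    formula. The factors \<open>pi\<close> cancel in the quotient, and the index denominators leave
    \<open>(n - r) / n\<close>.\<close>
  have R: "R = \<bar>q\<bar>"
  proof -
    define A B where "A = sin (real n * \<Delta> / 2)" and "B = sin (real (n - r) * \<Delta> / 2)"
    have "q = A / (real n * pi) / (B / (real (n - r) * pi))"
      using assms(7,8) by (simp add: q_def a_coeff_def A_def B_def del: of_nat_diff)
    then have "q = real (n - r) / real n * (A / B)"
      by simp
    then show ?thesis
      unfolding R_def A_def B_def by simp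
  qed
  have \<rho>: "\<rho> ^ r = 1"
    using assms(7) by (simp add: \<rho>_def flip: exp_of_nat_mult)
  \<comment> \<open>The equal spacing of the centres enters here: together with the common length
    \<open>\<Delta>\<close> it lets one \<open>c\<close> meet the conditions of all arcs.\<close>
  have xr: "x j ^ r = x 1 ^ r" if "j \<in> {1..r}" for j
  proof -
    have "(\<rho> ^ (j - 1)) ^ r = (\<rho> ^ r) ^ (j - 1)"
      by (simp add: mult.commute flip: power_mult)
    moreover have "x j = x 1 * \<rho> ^ (j - 1)" using assms(13) that by blast
    ultimately show ?thesis using \<rho> by (simp add: power_mult_distrib)
  qed
  have "is_type_II (r + 1) w N (binom_poly n r c)"
  proof (rule is_type_II_binom_poly)
    fix j assume j: "j \<in> {1..r}"
    show "\<alpha> j \<le> \<beta> j \<and> {\<alpha> j..\<beta> j} \<subseteq> {0..<2 * pi}"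
      using j assms(9-11) by force
    show "of_real (a_coeff (\<beta> j - \<alpha> j) (int n)) * cis ((\<alpha> j + \<beta> j) / 2) ^ r
        = c * of_real (a_coeff (\<beta> j - \<alpha> j) (int (n - r)))"
      using xr[OF j] a j assms(10) by (simp add: c_def q_def x_def \<theta>_def)
  qed (use assms in auto)
  then have \<Phi>: "\<Phi> = binom_poly n r c" using assms(18,19) by blast
  \<comment> \<open>The real number \<open>q\<close> may be negative, so its sign is carried by
    \<open>Arg\<close>. The unreduced phase \<open>real r * \<theta> 1 + Arg q\<close> is kept
    because dividing it by \<open>r\<close> gives exactly the angles
    \<open>\<psi> k\<close>.\<close>
  have cpolar: "c = of_real R * cis (real r * \<theta> 1 + Arg (complex_of_real q))"
  proof -
    have "complex_of_real q = of_real R * cis (Arg (complex_of_real q))"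
      using rcis_cmod_Arg[of "complex_of_real q"] by (simp add: R rcis_def)
    moreover have "cis (real r * \<theta> 1 + Arg (complex_of_real q)) = cis (\<theta> 1) ^ r * cis (Arg (complex_of_real q))"
      by (simp add: Complex.DeMoivre cis_mult del: Arg_of_real)
    ultimately show ?thesis
      unfolding c_def x_def by (metis mult.assoc mult.commute)
  qed
  have \<zeta>: "\<zeta> = (\<lambda>k. complex_of_real (R powr (1 / real r))
      * cis ((real r * \<theta> 1 + Arg (complex_of_real q) + 2 * pi * real k) / real r))"
    unfolding \<zeta>_def R_def[symmetric] \<psi>_def using assms(7) by (simp add: add_divide_distrib add.assoc)
  have roots: "inj_on \<zeta> {..<r}" "{z. z ^ r = c} = \<zeta> ` {..<r}"
    unfolding \<zeta> using nth_roots_polar[OF assms(7) _ cpolar] q R by auto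
  have "c \<noteq> 0" using q by (simp add: c_def x_def)
  \<comment> \<open>Hence the nonzero zeros of \<Phi> are precisely the solutions of
    \<open>z ^ r = c\<close>.\<close>
  then have nz: "z \<noteq> 0" if "z ^ r = c" for z
    using that assms(7) by auto
  have fact: "poly \<Phi> z = z ^ (n - r) * (z ^ r - c)" for z
    using assms(8) by (simp add: \<Phi> poly_binom_poly right_diff_distrib flip: power_add)
  show ?thesis
  proof (intro conjI allI impI)
    show "poly \<Phi> z = z ^ n - (complex_of_real q * x 1 ^ r) * z ^ (n - r)" for z
      by (simp add: \<Phi> poly_binom_poly c_def)
    show "poly \<Phi> z = z ^ (n - r) * (z ^ r - complex_of_real q * x 1 ^ r)" for z
      using fact by (simp add: c_def)
    show "order 0 \<Phi> = n - r"
      unfolding \<Phi> using assms(7,8) \<open>c \<noteq> 0\<close> by (intro order_0_binom_poly) auto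
    show "inj_on \<zeta> {..<r}" by (fact roots)
    show "{z. z \<noteq> 0 \<and> poly \<Phi> z = 0} = \<zeta> ` {..<r}"
      unfolding roots(2)[symmetric] fact using nz by auto
    show "order (\<zeta> k) \<Phi> = 1" if "k < r" for k
    proof -
      have "\<zeta> k ^ r = c" using roots(2) that by blast
      with nz assms(7,8) show ?thesis
        unfolding \<Phi> by (intro order_root_binom_poly) auto
    qed
    show "Arg (complex_of_real q) \<in> {0, pi}"
      by (cases "q > 0") (use q in \<open>auto simp: Arg_of_real\<close>)
  qed
qed

end
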